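(* Let $\mathbf{FStoch}$ be the symmetric monoidal category of finite sets and matrices with nonnegative real entries, where each finite set $A$ is equipped with the completely mixed state $\mu_A\colon I\to A$ (the column vector of $1$s) and the discarding effect $\varepsilon_A\colon A\to I$ (the row vector of $1$s). Then $\mathbf{FStoch}$ has purification and copurification. Hence the pairs $(\mathcal M,\mathcal P)$ (mixing and pure morphisms) and $(\mathcal C,\mathcal D)$ (copure and discarding morphisms) are symmetric monoidal weak factorisation systems.
   Context: $\mathbf{FStoch}$: objects are finite sets; a morphism $f\colon X\to Y$ is a matrix $(f_{yx})_{y\in Y,x\in X}$ of nonnegative reals, with the domain labelling the columns and the codomain labelling the rows (no normalisation). Composition is matrix multiplication; the monoidal product is the Cartesian product of sets and the Kronecker product of matrices; the unit $I$ is a one-element set. Lifting: for morphisms $f\colon A\to B$ and $g\colon C\to D$ of a category, $f$ has the lifting property against $g$ when for all $u\colon A\to C$, $v\colon B\to D$ with $g\circ u=v\circ f$ there is $h\colon B\to C$ with $h\circ f=u$ and $g\circ h=v$. In a symmetric monoidal category, $f\oslash g$ means: for all objects $A',B'$, the morphism $f\otimes\mathrm{id}_{A'}$ has the lifting property against $g\otimes\mathrm{id}_{B'}$. For a collection $\mathcal A$ of morphisms, $\mathcal A^{\oslash}=\{g\mid \forall f\in\mathcal A\colon f\oslash g\}$ and ${}^{\oslash}\mathcal A=\{f\mid\forall g\in\mathcal A\colon f\oslash g\}$. Let $\mathcal M'$ be the collection of all completely mixed states $\mu_A$ and $\mathcal D'$ the collection of all discarding effects $\varepsilon_A$ ($A$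 ranging over all finite sets). Pure morphisms: $\mathcal P=\mathcal M'^{\oslash}$; mixing morphisms: $\mathcal M={}^{\oslash}\mathcal P$; copure morphisms: $\mathcal C={}^{\oslash}\mathcal D'$; discarding morphisms: $\mathcal D=\mathcal C^{\oslash}$. The category has purification if every morphism $f\colon A\to B$ equals $p\circ(\mathrm{id}_A\otimes\mu_C)$ for some object $C$ and some pure $p\colon A\otimes C\to B$ (identifying $A$ with $A\otimes I$). It has copurification if every morphism $f\colon A\to B$ equals $(\varepsilon_C\otimes\mathrm{id}_B)\circ c$ for some object $C$ and some copure $c\colon A\to C\otimes B$ (identifying $I\otimes B$ with $B$). A symmetric monoidal weak factorisation system is a pair $(\mathcal L,\mathcal R)$ of collections of morphisms such that every morphism can be written as $r\circ l$ with $l\in\mathcal L$, $r\in\mathcal R$, and such that $\mathcal L={}^{\oslash}\mathcal R$ and $\mathcal R=\mathcal L^{\oslash}$.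
   Formalization: Purification and copurification are proved with completely mixed states and discarding effects taken only for nonempty finite sets, as both fail if the empty set's are included; the two factorisation systems are proved under both conventions. *)

theory Defs
  imports Complex_Main
begin

text \<open>
  Objects have to be sets over one type that contains a one-element set and is closed under
  Cartesian products.  The type \<open>'a point\<close> is freely generated by the elements of an arbitrary
  type \<open>'a\<close>, one further point and pairing.  So each finite set over \<open>'a\<close> occurs as an object,
  and, whatever \<open>'a\<close> is, there are objects of every finite cardinality.
\<close>

datatype 'a point = Star | Atom 'a | Tup "'a point" "'a point"

definition finite_sets :: "'a point set set"
  where "finite_sets = {A. finite A}"

definition nonempty_finite_sets :: "'a point set set"
  where "nonempty_finite_sets = {A. finite A \<and> A \<noteq> {}}"

definition unit_obj :: "'a point set"
  where "unit_obj = {Star}"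

definition tensor_obj :: "'a point set \<Rightarrow> 'a point set \<Rightarrow> 'a point set"  (infixr "\<otimes>\<^sub>o" 70)
  where "A \<otimes>\<^sub>o B = {Tup a b | a b. a \<in> A \<and> b \<in> B}"

text \<open>
  \<open>entry f y x\<close> is the entry in row \<open>y\<close> and column \<open>x\<close>.  Entries outside
  \<open>cod f \<times> dom f\<close> are required to be \<open>0\<close>, so that equality of morphisms is equality of records.
\<close>

record 'a morphism =
  dom :: "'a point set"
  cod :: "'a point set"
  entry :: "'a point \<Rightarrow> 'a point \<Rightarrow> real"

definition FStoch :: "'a morphism set"
  where "FStoch = {f. dom f \<in> finite_sets \<and> cod f \<in> finite_sets \<and>
    (\<forall>y x. 0 \<le> entry f y x) \<and>
    (\<forall>y x. \<not> (y \<in> cod f \<and> x \<in> dom f) \<longrightarrow> entry f y x = 0)}"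

definition hom :: "'a point set \<Rightarrow> 'a point set \<Rightarrow> 'a morphism set"
  where "hom A B = {f \<in> FStoch. dom f = A \<and> cod f = B}"

definition comp :: "'a morphism \<Rightarrow> 'a morphism \<Rightarrow> 'a morphism"  (infixr "\<cdot>" 65)
  where "g \<cdot> f = \<lparr>dom = dom f, cod = cod g,
    entry = (\<lambda>z x. \<Sum>y\<in>cod f. entry g z y * entry f y x)\<rparr>"

definition ident :: "'a point set \<Rightarrow> 'a morphism"
  where "ident A = \<lparr>dom = A, cod = A, entry = (\<lambda>y x. if y = x \<and> x \<in> A then 1 else 0)\<rparr>"

definition tensor :: "'a morphism \<Rightarrow> 'a morphism \<Rightarrow> 'a morphism"  (infixr "\<otimes>" 70)
  where "f \<otimes> g = \<lparr>dom = dom f \<otimes>\<^sub>o dom g, cod = cod f \<otimes>\<^sub>o cod g,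
    entry = (\<lambda>p q. case (p, q) of
      (Tup b d, Tup a c) \<Rightarrow> entry f b a * entry g d c
    | _ \<Rightarrow> 0)\<rparr>"

text \<open>The identifications of \<open>A\<close> with \<open>A \<otimes> I\<close> and of \<open>I \<otimes> B\<close> with \<open>B\<close>.\<close>

definition runit_inv :: "'a point set \<Rightarrow> 'a morphism"
  where "runit_inv A = \<lparr>dom = A, cod = A \<otimes>\<^sub>o unit_obj,
    entry = (\<lambda>p a. if a \<in> A \<and> p = Tup a Star then 1 else 0)\<rparr>"

definition lunit :: "'a point set \<Rightarrow> 'a morphism"
  where "lunit B = \<lparr>dom = unit_obj \<otimes>\<^sub>o B, cod = B,
    entry = (\<lambda>b p. if b \<in> B \<and> p = Tup Star b then 1 else 0)\<rparr>"

definition mixed_state :: "'a point set \<Rightarrow> 'a morphism"  ("\<mu>")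
  where "\<mu> A = \<lparr>dom = unit_obj, cod = A,
    entry = (\<lambda>a s. if a \<in> A \<and> s \<in> unit_obj then 1 else 0)\<rparr>"

definition discard_effect :: "'a point set \<Rightarrow> 'a morphism"  ("\<epsilon>")
  where "\<epsilon> A = \<lparr>dom = A, cod = unit_obj,
    entry = (\<lambda>s a. if s \<in> unit_obj \<and> a \<in> A then 1 else 0)\<rparr>"

definition lifts :: "'a morphism \<Rightarrow> 'a morphism \<Rightarrow> bool"
  where "lifts f g \<longleftrightarrow>
    (\<forall>u \<in> hom (dom f) (dom g). \<forall>v \<in> hom (cod f) (cod g). g \<cdot> u = v \<cdot> f \<longrightarrow>
      (\<exists>h \<in> hom (cod f) (dom g). h \<cdot> f = u \<and> g \<cdot> h = v))"

definition monoidal_lifts :: "'a morphism \<Rightarrow> 'a morphism \<Rightarrow> bool"  (infix "\<oslash>" 50)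
  where "f \<oslash> g \<longleftrightarrow>
    (\<forall>A' \<in> finite_sets. \<forall>B' \<in> finite_sets. lifts (f \<otimes> ident A') (g \<otimes> ident B'))"

definition right_class :: "'a morphism set \<Rightarrow> 'a morphism set"
  where "right_class \<A> = {g \<in> FStoch. \<forall>f \<in> \<A>. f \<oslash> g}"

definition left_class :: "'a morphism set \<Rightarrow> 'a morphism set"
  where "left_class \<A> = {f \<in> FStoch. \<forall>g \<in> \<A>. f \<oslash> g}"

text \<open>
  The parameter \<open>\<S>\<close> is the collection of those objects \<open>A\<close> whose \<open>\<mu> A\<close> and \<open>\<epsilon> A\<close> are the
  distinguished states and effects; the category always has all finite sets as objects.
  It cannot simply be fixed to \<open>finite_sets\<close>: if the matrices \<open>\<mu> {}\<close> and \<open>\<epsilon> {}\<close> are included,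
  then pure morphisms have no zero column and copure ones no zero row, and both purification
  and copurification fail (\<open>not_has_purification_finite_sets\<close> and
  \<open>not_has_copurification_finite_sets\<close> below).
\<close>

definition pure :: "'a point set set \<Rightarrow> 'a morphism set"
  where "pure \<S> = right_class (\<mu> ` \<S>)"

definition mixing :: "'a point set set \<Rightarrow> 'a morphism set"
  where "mixing \<S> = left_class (pure \<S>)"

definition copure :: "'a point set set \<Rightarrow> 'a morphism set"
  where "copure \<S> = left_class (\<epsilon> ` \<S>)"

definition discarding :: "'a point set set \<Rightarrow> 'a morphism set"
  where "discarding \<S> = right_class (copure \<S>)"

definition has_purification :: "'a point set set \<Rightarrow> bool"
  where "has_purification \<S> \<longleftrightarrow>
    (\<forall>A \<in> finite_sets. \<forall>B \<in> finite_sets. \<forall>f \<in> hom A B.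
      \<exists>C \<in> \<S>. \<exists>p \<in> hom (A \<otimes>\<^sub>o C) B. p \<in> pure \<S> \<and>
        f = p \<cdot> (ident A \<otimes> \<mu> C) \<cdot> runit_inv A)"

definition has_copurification :: "'a point set set \<Rightarrow> bool"
  where "has_copurification \<S> \<longleftrightarrow>
    (\<forall>A \<in> finite_sets. \<forall>B \<in> finite_sets. \<forall>f \<in> hom A B.
      \<exists>C \<in> \<S>. \<exists>c \<in> hom A (C \<otimes>\<^sub>o B). c \<in> copure \<S> \<and>
        f = lunit B \<cdot> (\<epsilon> C \<otimes> ident B) \<cdot> c)"

definition monoidal_wfs :: "'a morphism set \<Rightarrow> 'a morphism set \<Rightarrow> bool"
  where "monoidal_wfs \<L> \<R> \<longleftrightarrow>
    (\<forall>f \<in> FStoch. \<exists>l \<in> \<L>. \<exists>r \<in> \<R>. cod l = dom r \<and> f = r \<cdot> l) \<and>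
    \<L> = left_class \<R> \<and> \<R> = right_class \<L>"

lemma finite_tensor_obj [simp]: "finite A \<Longrightarrow> finite B \<Longrightarrow> finite (A \<otimes>\<^sub>o B)"
proof -
  assume "finite A" "finite B"
  moreover have "A \<otimes>\<^sub>o B = (\<lambda>(a, b). Tup a b) ` (A \<times> B)" by (auto simp: tensor_obj_def)
  ultimately show ?thesis by simp
qed

lemma pure_finite_sets_column:
  assumes "p \<in> pure finite_sets" and x: "x \<in> dom p"
  shows "\<exists>y. entry p y x \<noteq> 0"
proof (rule ccontr)
  assume "\<not> ?thesis"
  then have zero: "entry p y x = 0" for y by auto
  let ?I = "ident unit_obj"
  have p: "p \<in> FStoch" and "\<mu> {} \<oslash> p"
    using assms(1) by (auto simp: pure_def right_class_def finite_sets_def)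
  then have l: "lifts (\<mu> {} \<otimes> ?I) (p \<otimes> ?I)"
    by (simp add: monoidal_lifts_def finite_sets_def unit_obj_def)
  define u where "u = \<lparr>dom = unit_obj \<otimes>\<^sub>o unit_obj, cod = dom p \<otimes>\<^sub>o unit_obj,
    entry = (\<lambda>z w. if z = Tup x Star \<and> w = Tup Star Star then 1 else 0)\<rparr>"
  define v where "v = \<lparr>dom = {} \<otimes>\<^sub>o unit_obj, cod = cod p \<otimes>\<^sub>o unit_obj, entry = (\<lambda>_ _. 0)\<rparr>"
  have "finite (dom p)" "finite (cod p)" using p by (auto simp: FStoch_def finite_sets_def)
  then have u: "u \<in> hom (dom (\<mu> {} \<otimes> ?I)) (dom (p \<otimes> ?I))"
    and v: "v \<in> hom (cod (\<mu> {} \<otimes> ?I)) (cod (p \<otimes> ?I))"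
    using x finite_tensor_obj
    by (auto simp: u_def v_def hom_def FStoch_def finite_sets_def tensor_def mixed_state_def
        ident_def unit_obj_def tensor_obj_def)
  have "(p \<otimes> ?I) \<cdot> u = v \<cdot> (\<mu> {} \<otimes> ?I)"
    using zero
    by (auto simp: comp_def u_def v_def tensor_def mixed_state_def ident_def tensor_obj_def fun_eq_iff
        split: point.splits intro!: sum.neutral)
  then obtain h where "h \<cdot> (\<mu> {} \<otimes> ?I) = u"
    using l u v by (auto simp: lifts_def)
  then have "entry (h \<cdot> (\<mu> {} \<otimes> ?I)) (Tup x Star) (Tup Star Star) = 1" by (simp add: u_def)
  then show False by (simp add: comp_def tensor_def mixed_state_def tensor_obj_def)
qed

lemma copure_finite_sets_row:
  assumes "c \<in> copure finite_sets" and y: "y \<in> cod c"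
  shows "\<exists>x. entry c y x \<noteq> 0"
proof (rule ccontr)
  assume "\<not> ?thesis"
  then have zero: "entry c y x = 0" for x by auto
  let ?I = "ident unit_obj"
  have c: "c \<in> FStoch" and "c \<oslash> \<epsilon> {}"
    using assms(1) by (auto simp: copure_def left_class_def finite_sets_def)
  then have l: "lifts (c \<otimes> ?I) (\<epsilon> {} \<otimes> ?I)"
    by (simp add: monoidal_lifts_def finite_sets_def unit_obj_def)
  define u where "u = \<lparr>dom = dom c \<otimes>\<^sub>o unit_obj, cod = {} \<otimes>\<^sub>o unit_obj, entry = (\<lambda>_ _. 0)\<rparr>"
  define v where "v = \<lparr>dom = cod c \<otimes>\<^sub>o unit_obj, cod = unit_obj \<otimes>\<^sub>o unit_obj,
    entry = (\<lambda>z w. if z = Tup Star Star \<and> w = Tup y Star then 1 else 0)\<rparr>"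
  have "finite (dom c)" "finite (cod c)" using c by (auto simp: FStoch_def finite_sets_def)
  then have u: "u \<in> hom (dom (c \<otimes> ?I)) (dom (\<epsilon> {} \<otimes> ?I))"
    and v: "v \<in> hom (cod (c \<otimes> ?I)) (cod (\<epsilon> {} \<otimes> ?I))"
    using y finite_tensor_obj
    by (auto simp: u_def v_def hom_def FStoch_def finite_sets_def tensor_def discard_effect_def
        ident_def unit_obj_def tensor_obj_def)
  have "(\<epsilon> {} \<otimes> ?I) \<cdot> u = v \<cdot> (c \<otimes> ?I)"
    using zero
    by (auto simp: comp_def u_def v_def tensor_def discard_effect_def ident_def tensor_obj_def fun_eq_iff
        split: point.splits intro!: sum.neutral)
  then obtain h where "(\<epsilon> {} \<otimes> ?I) \<cdot> h = v" and "h \<in> hom (cod (c \<otimes> ?I)) (dom (\<epsilon> {} \<otimes> ?I))"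
    using l u v by (auto simp: lifts_def)
  then have "entry ((\<epsilon> {} \<otimes> ?I) \<cdot> h) (Tup Star Star) (Tup y Star) = 1" and "cod h = {}"
    by (auto simp: v_def hom_def tensor_def discard_effect_def tensor_obj_def)
  then show False by (simp add: comp_def)
qed

lemma not_has_purification_finite_sets:
  "\<not> has_purification (finite_sets :: 'a point set set)"
proof
  assume *: "has_purification (finite_sets :: 'a point set set)"
  define s t :: "'a point" where "s = Star" and "t = Tup Star Star"
  have st: "s \<noteq> t" by (simp add: s_def t_def)
  define f where "f = \<lparr>dom = {s, t}, cod = unit_obj,
    entry = (\<lambda>y x. if y = Star \<and> x = t then 1 else 0)\<rparr>"
  have "f \<in> hom {s, t} unit_obj"
    by (auto simp: f_def hom_def FStoch_def finite_sets_def unit_obj_def)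
  with * obtain C p where C: "finite C" and p: "p \<in> hom ({s, t} \<otimes>\<^sub>o C) unit_obj"
    "p \<in> pure finite_sets" and f: "f = p \<cdot> (ident {s, t} \<otimes> \<mu> C) \<cdot> runit_inv {s, t}"
    unfolding has_purification_def finite_sets_def by (metis (mono_tags, lifting) finite.intros mem_Collect_eq unit_obj_def)
  have tens: "{s, t} \<otimes>\<^sub>o unit_obj = {Tup s Star, Tup t Star}"
    "{s, t} \<otimes>\<^sub>o C = Tup s ` C \<union> Tup t ` C" by (auto simp: tensor_obj_def unit_obj_def)
  have ct: "cod (ident {s, t} \<otimes> \<mu> C) = Tup s ` C \<union> Tup t ` C"
    "cod (runit_inv {s, t}) = {Tup s Star, Tup t Star}"
    by (simp_all add: tensor_def mixed_state_def ident_def runit_inv_def tens)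
  have e: "entry f Star a = (\<Sum>c\<in>C. entry p Star (Tup a c))" if a: "a \<in> {s, t}" for a
  proof -
    have "entry f Star a = (\<Sum>z\<in>Tup s ` C \<union> Tup t ` C. entry p Star z *
        entry (ident {s, t} \<otimes> \<mu> C) z (Tup a Star))"
      using a st unfolding f
      by (auto simp: comp_def ct) (auto simp: runit_inv_def)
    also have "\<dots> = (\<Sum>z\<in>Tup a ` C. entry p Star z)"
      using C a st
      by (intro sum.mono_neutral_cong_right)
        (auto simp: tensor_def ident_def mixed_state_def unit_obj_def)
    also have "\<dots> = (\<Sum>c\<in>C. entry p Star (Tup a c))"
      by (subst sum.reindex) (auto simp: inj_on_def)
    finally show ?thesis .
  qed
  have nn: "0 \<le> entry p y x" for y x using p by (simp add: hom_def FStoch_def)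
  have "(\<Sum>c\<in>C. entry p Star (Tup t c)) = 1" using e[of t] by (simp add: f_def)
  then obtain c where c: "c \<in> C" by fastforce
  have "(\<Sum>c\<in>C. entry p Star (Tup s c)) = 0" using e[of s] st by (simp add: f_def)
  then have z: "entry p Star (Tup s c) = 0" using c C nn by (simp add: sum_nonneg_eq_0_iff)
  have "Tup s c \<in> dom p" using p c by (auto simp: hom_def tens)
  then obtain y where y: "entry p y (Tup s c) \<noteq> 0" using pure_finite_sets_column p by blast
  then have "y = Star" using p by (auto simp: hom_def FStoch_def unit_obj_def)
  with y z show False by simp
qed

lemma not_has_copurification_finite_sets:
  "\<not> has_copurification (finite_sets :: 'a point set set)"
proof
  assume *: "has_copurification (finite_sets :: 'a point set set)"
  define s t :: "'a point" where "s = Star" and "t = Tup Star Star"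
  have st: "s \<noteq> t" by (simp add: s_def t_def)
  define f where "f = \<lparr>dom = unit_obj, cod = {s, t},
    entry = (\<lambda>y x. if y = t \<and> x = Star then 1 else 0)\<rparr>"
  have "f \<in> hom unit_obj {s, t}"
    by (auto simp: f_def hom_def FStoch_def finite_sets_def unit_obj_def)
  with * obtain C c where C: "finite C" and c: "c \<in> hom unit_obj (C \<otimes>\<^sub>o {s, t})"
    "c \<in> copure finite_sets" and f: "f = lunit {s, t} \<cdot> (\<epsilon> C \<otimes> ident {s, t}) \<cdot> c"
    unfolding has_copurification_def finite_sets_def by (metis (mono_tags, lifting) finite.intros mem_Collect_eq unit_obj_def)
  have tens: "unit_obj \<otimes>\<^sub>o {s, t} = {Tup Star s, Tup Star t}"
    "C \<otimes>\<^sub>o {s, t} = (\<lambda>d. Tup d s) ` C \<union> (\<lambda>d. Tup d t) ` C"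
    by (auto simp: tensor_obj_def unit_obj_def)
  have cc: "cod c = (\<lambda>d. Tup d s) ` C \<union> (\<lambda>d. Tup d t) ` C" using c by (simp add: hom_def tens)
  have ct: "cod (\<epsilon> C \<otimes> ident {s, t}) = {Tup Star s, Tup Star t}"
    by (simp add: tensor_def discard_effect_def ident_def tens)
  have e: "entry f b Star = (\<Sum>d\<in>C. entry c (Tup d b) Star)" if b: "b \<in> {s, t}" for b
  proof -
    have "entry f b Star = (\<Sum>z\<in>cod c. entry (\<epsilon> C \<otimes> ident {s, t}) (Tup Star b) z * entry c z Star)"
      using b st unfolding f
      by (auto simp: comp_def ct lunit_def)
    also have "\<dots> = (\<Sum>z\<in>(\<lambda>d. Tup d b) ` C. entry c z Star)"
      unfolding cc using C b st
      by (intro sum.mono_neutral_cong_right)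
        (auto simp: tensor_def ident_def discard_effect_def unit_obj_def)
    also have "\<dots> = (\<Sum>d\<in>C. entry c (Tup d b) Star)"
      by (subst sum.reindex) (auto simp: inj_on_def)
    finally show ?thesis .
  qed
  have nn: "0 \<le> entry c y x" for y x using c by (simp add: hom_def FStoch_def)
  have "(\<Sum>d\<in>C. entry c (Tup d t) Star) = 1" using e[of t] by (simp add: f_def)
  then obtain d where d: "d \<in> C" by fastforce
  have "(\<Sum>d\<in>C. entry c (Tup d s) Star) = 0" using e[of s] st by (simp add: f_def)
  then have z: "entry c (Tup d s) Star = 0" using d C nn by (simp add: sum_nonneg_eq_0_iff)
  have "Tup d s \<in> cod c" using d by (auto simp: cc)
  then obtain x where x: "entry c (Tup d s) x \<noteq> 0" using copure_finite_sets_row c by blast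
  then have "x = Star" using c by (auto simp: hom_def FStoch_def unit_obj_def)
  with x z show False by simp
qed

end

theory Submission
  imports Defs
begin

text \<open>
  Tensoring with identities splits a lifting problem of \<open>\<mu> C\<close> against \<open>p\<close> into problems about
  vectors: given \<open>u \<ge> 0\<close> and a decomposition of \<open>p u\<close> into nonnegative summands indexed by \<open>C\<close>,
  lift it to a decomposition of \<open>u\<close>.  If each column of \<open>p\<close> has at most one nonzero entry, this is
  solved by splitting \<open>u\<close> in the proportions prescribed on \<open>p u\<close>; a zero column imposes no
  condition, but needs \<open>C\<close> to be nonempty.  The same lifting property lets the 0-1 matrix of a map
  \<open>\<pi> : Y \<rightarrow> X\<close> with fibres in \<open>\<S>\<close>, read as a morphism \<open>X \<rightarrow> Y\<close>, lift against \<open>p\<close>.  A matrix \<open>f\<close>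
  factors through a set of pairs \<open>(a, b)\<close> containing its support: first the matrix of the
  projection to \<open>a\<close>, then the entries \<open>f b a\<close>.  For nonempty \<open>\<S>\<close> a full product of
  objects will do; if \<open>{} \<in> \<S>\<close>, the support itself has to be taken.  Everything about effects
  follows by transposing matrices.
\<close>

section \<open>Matrices\<close>

lemma morphism_eqI:
  assumes "f \<in> hom A B" "g \<in> hom A B"
    and "\<And>y x. y \<in> B \<Longrightarrow> x \<in> A \<Longrightarrow> entry f y x = entry g y x"
  shows "f = g"
proof -
  have "entry f y x = entry g y x" for y x
    using assms by (cases "y \<in> B \<and> x \<in> A") (auto simp: hom_def FStoch_def)
  then show ?thesis
    using assms(1,2) by (auto simp: hom_def intro!: morphism.equality)
qed

lemma mem_finite_sets_iff [simp]: "A \<in> finite_sets \<longleftrightarrow> finite A"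
  by (simp add: finite_sets_def)

lemma finite_unit_obj [simp]: "finite unit_obj"
  by (simp add: unit_obj_def)

lemma Tup_in_tensor_obj [simp]: "Tup a b \<in> A \<otimes>\<^sub>o B \<longleftrightarrow> a \<in> A \<and> b \<in> B"
  by (auto simp: tensor_obj_def)

lemma tensor_objE:
  assumes "z \<in> A \<otimes>\<^sub>o B"
  obtains a b where "z = Tup a b" "a \<in> A" "b \<in> B"
  using assms by (auto simp: tensor_obj_def)

lemma homD:
  assumes "f \<in> hom A B"
  shows "dom f = A" "cod f = B" "finite A" "finite B" "0 \<le> entry f y x"
    "\<not> (y \<in> B \<and> x \<in> A) \<Longrightarrow> entry f y x = 0" "f \<in> FStoch"
  using assms by (auto simp: hom_def FStoch_def)

lemma homI:
  assumes "dom f = A" "cod f = B" "finite A" "finite B" "\<And>y x. 0 \<le> entry f y x"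
    "\<And>y x. \<not> (y \<in> B \<and> x \<in> A) \<Longrightarrow> entry f y x = 0"
  shows "f \<in> hom A B"
  using assms unfolding hom_def FStoch_def by auto

lemma FStoch_hom: "f \<in> FStoch \<Longrightarrow> f \<in> hom (dom f) (cod f)"
  by (simp add: hom_def)

lemma dom_comp [simp]: "dom (g \<cdot> f) = dom f"
  and cod_comp [simp]: "cod (g \<cdot> f) = cod g"
  and dom_ident [simp]: "dom (ident A) = A"
  and cod_ident [simp]: "cod (ident A) = A"
  and dom_tensor [simp]: "dom (f \<otimes> g) = dom f \<otimes>\<^sub>o dom g"
  and cod_tensor [simp]: "cod (f \<otimes> g) = cod f \<otimes>\<^sub>o cod g"
  and dom_mixed [simp]: "dom (\<mu> A) = unit_obj"
  and cod_mixed [simp]: "cod (\<mu> A) = A"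
  and dom_discard [simp]: "dom (\<epsilon> A) = A"
  and cod_discard [simp]: "cod (\<epsilon> A) = unit_obj"
  by (simp_all add: comp_def ident_def tensor_def mixed_state_def discard_effect_def)

lemma entry_tensor [simp]: "entry (f \<otimes> g) (Tup b d) (Tup a c) = entry f b a * entry g d c"
  by (simp add: tensor_def)

lemma entry_ident: "entry (ident A) y x = (if y = x \<and> x \<in> A then 1 else 0)"
  by (simp add: ident_def)

lemma comp_hom: "f \<in> hom A B \<Longrightarrow> g \<in> hom B C \<Longrightarrow> g \<cdot> f \<in> hom A C"
  by (rule homI) (auto simp: homD comp_def intro!: sum_nonneg sum.neutral)

lemma ident_hom: "finite A \<Longrightarrow> ident A \<in> hom A A"
  by (rule homI) (auto simp: ident_def)

lemma tensor_hom:
  assumes "f \<in> hom A B" "g \<in> hom C D"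
  shows "f \<otimes> g \<in> hom (A \<otimes>\<^sub>o C) (B \<otimes>\<^sub>o D)"
proof (rule homI)
  fix y x
  show "0 \<le> entry (f \<otimes> g) y x"
    using homD(5)[OF assms(1)] homD(5)[OF assms(2)]
    by (auto simp: tensor_def split: point.splits)
  show "entry (f \<otimes> g) y x = 0" if "\<not> (y \<in> B \<otimes>\<^sub>o D \<and> x \<in> A \<otimes>\<^sub>o C)"
    using that homD(6)[OF assms(1)] homD(6)[OF assms(2)]
    by (auto simp: tensor_def split: point.splits)
qed (use assms in \<open>auto simp: homD\<close>)

lemma mixed_hom: "finite A \<Longrightarrow> \<mu> A \<in> hom unit_obj A"
  by (rule homI) (auto simp: mixed_state_def)

lemma discard_hom: "finite A \<Longrightarrow> \<epsilon> A \<in> hom A unit_obj"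
  by (rule homI) (auto simp: discard_effect_def)

lemma runit_inv_hom: "finite A \<Longrightarrow> runit_inv A \<in> hom A (A \<otimes>\<^sub>o unit_obj)"
  by (rule homI) (auto simp: runit_inv_def unit_obj_def)

lemma lunit_hom: "finite A \<Longrightarrow> lunit A \<in> hom (unit_obj \<otimes>\<^sub>o A) A"
  by (rule homI) (auto simp: lunit_def unit_obj_def)

text \<open>The identity factor kills every summand whose second component differs from
  \<open>b\<close>, so tensoring with \<open>ident B\<close> leaves one independent copy of
  \<open>g\<close> for each \<open>b\<close>. This and the next lemma are what decouples a monoidal
  lifting problem into problems about vectors.\<close>

lemma entry_tensor_ident_comp:
  assumes "g \<in> hom C D" "u \<in> hom X (C \<otimes>\<^sub>o B)" "b \<in> B"
  shows "entry ((g \<otimes> ident B) \<cdot> u) (Tup d b) z = (\<Sum>c\<in>C. entry g d c * entry u (Tup c b) z)"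
proof -
  have "entry ((g \<otimes> ident B) \<cdot> u) (Tup d b) z
      = (\<Sum>w\<in>C \<otimes>\<^sub>o B. entry (g \<otimes> ident B) (Tup d b) w * entry u w z)"
    using assms by (simp add: comp_def homD)
  also have "\<dots> = (\<Sum>w\<in>(\<lambda>c. Tup c b) ` C. entry (g \<otimes> ident B) (Tup d b) w * entry u w z)"
    using assms homD(3)[OF assms(1)] homD(4)[OF assms(2)]
    by (intro sum.mono_neutral_right) (auto simp: entry_ident elim!: tensor_objE)
  also have "\<dots> = (\<Sum>c\<in>C. entry g d c * entry u (Tup c b) z)"
    using assms by (subst sum.reindex) (auto simp: inj_on_def entry_ident)
  finally show ?thesis .
qed

lemma entry_comp_tensor_ident:
  assumes "f \<in> hom X Y" "h \<in> hom (Y \<otimes>\<^sub>o A) Z" "a \<in> A"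
  shows "entry (h \<cdot> (f \<otimes> ident A)) z (Tup x a) = (\<Sum>y\<in>Y. entry h z (Tup y a) * entry f y x)"
proof -
  have "entry (h \<cdot> (f \<otimes> ident A)) z (Tup x a)
      = (\<Sum>w\<in>Y \<otimes>\<^sub>o A. entry h z w * entry (f \<otimes> ident A) w (Tup x a))"
    using assms by (simp add: comp_def homD)
  also have "\<dots> = (\<Sum>w\<in>(\<lambda>y. Tup y a) ` Y. entry h z w * entry (f \<otimes> ident A) w (Tup x a))"
    using assms homD(4)[OF assms(1)] homD(3)[OF assms(2)]
    by (intro sum.mono_neutral_right) (auto simp: entry_ident elim!: tensor_objE split: if_splits)
  also have "\<dots> = (\<Sum>y\<in>Y. entry h z (Tup y a) * entry f y x)"
    using assms by (subst sum.reindex) (auto simp: inj_on_def entry_ident)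
  finally show ?thesis .
qed

section \<open>Lifting decompositions\<close>

text \<open>This is lifting of \<open>\<mu> C\<close> against \<open>p\<close> with both auxiliary
  objects equal to the unit: \<open>u\<close> is a state on \<open>dom p\<close>, \<open>v\<close>
  and \<open>h\<close> are families of states indexed by \<open>C\<close>, and composing with
  \<open>\<mu> C\<close> sums a family. The functions are total, but the equations constrain them
  only on the objects concerned.\<close>

definition lifts_decompositions :: "'a point set set \<Rightarrow> 'a morphism \<Rightarrow> bool"
  where "lifts_decompositions \<S> p \<longleftrightarrow>
    (\<forall>C\<in>\<S>. \<forall>u v. (\<forall>x. 0 \<le> u x) \<and> (\<forall>c d. 0 \<le> v c d) \<and>
      (\<forall>d\<in>cod p. (\<Sum>x\<in>dom p. entry p d x * u x) = (\<Sum>c\<in>C. v c d)) \<longrightarrow>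
      (\<exists>h. (\<forall>c x. 0 \<le> h c x) \<and> (\<forall>x\<in>dom p. (\<Sum>c\<in>C. h c x) = u x) \<and>
        (\<forall>c\<in>C. \<forall>d\<in>cod p. (\<Sum>x\<in>dom p. entry p d x * h c x) = v c d)))"

text \<open>The transpose of the usual matrix of \<pi>: column \<open>x\<close> is the completely
  mixed state on the fibre over \<open>x\<close>, extended by 0.\<close>

definition fibre_matrix :: "'a point set \<Rightarrow> 'a point set \<Rightarrow> ('a point \<Rightarrow> 'a point) \<Rightarrow> 'a morphism"
  where "fibre_matrix X Y \<pi> = \<lparr>dom = X, cod = Y,
    entry = (\<lambda>y x. if y \<in> Y \<and> x \<in> X \<and> \<pi> y = x then 1 else 0)\<rparr>"

lemma fibre_matrix_hom: "finite X \<Longrightarrow> finite Y \<Longrightarrow> fibre_matrix X Y \<pi> \<in> hom X Y"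
  by (rule homI) (auto simp: fibre_matrix_def)

lemma sum_fibre_matrix:
  assumes "finite Y" "x \<in> X"
  shows "(\<Sum>y\<in>Y. g y * entry (fibre_matrix X Y \<pi>) y x) = (\<Sum>y\<in>{y \<in> Y. \<pi> y = x}. g y)"
  using assms by (intro sum.mono_neutral_cong_right) (auto simp: fibre_matrix_def)

lemma pure_lifts_decompositions:
  assumes \<S>: "\<S> \<subseteq> finite_sets" and p: "p \<in> pure \<S>"
  shows "lifts_decompositions \<S> p"
  unfolding lifts_decompositions_def
proof (intro ballI allI impI, elim conjE)
  fix C and u :: "'a point \<Rightarrow> real" and v :: "'a point \<Rightarrow> 'a point \<Rightarrow> real"
  assume C: "C \<in> \<S>" and u0: "\<forall>x. 0 \<le> u x" and v0: "\<forall>c d. 0 \<le> v c d"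
    and uv: "\<forall>d\<in>cod p. (\<Sum>x\<in>dom p. entry p d x * u x) = (\<Sum>c\<in>C. v c d)"
  let ?I = "ident unit_obj"
  have p': "p \<in> hom (dom p) (cod p)" and "\<mu> C \<oslash> p"
    using p C by (auto simp: pure_def right_class_def FStoch_hom)
  then have l: "lifts (\<mu> C \<otimes> ?I) (p \<otimes> ?I)"
    by (simp add: monoidal_lifts_def)
  have fin: "finite C" "finite (dom p)" "finite (cod p)"
    using \<S> C homD(3,4)[OF p'] by auto
  \<comment> \<open>\<open>U\<close> and \<open>V\<close> encode the vectors as matrices between
    products with the unit, cut off to 0 elsewhere so that they lie in
    \<open>FStoch\<close>.\<close>
  define U where "U = \<lparr>dom = unit_obj \<otimes>\<^sub>o unit_obj, cod = dom p \<otimes>\<^sub>o unit_obj,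
    entry = (\<lambda>z w. case z of Tup x s \<Rightarrow>
      if x \<in> dom p \<and> s = Star \<and> w = Tup Star Star then u x else 0 | _ \<Rightarrow> 0)\<rparr>"
  define V where "V = \<lparr>dom = C \<otimes>\<^sub>o unit_obj, cod = cod p \<otimes>\<^sub>o unit_obj,
    entry = (\<lambda>z w. case (z, w) of (Tup d s, Tup c t) \<Rightarrow>
      if d \<in> cod p \<and> c \<in> C \<and> s = Star \<and> t = Star then v c d else 0 | _ \<Rightarrow> 0)\<rparr>"
  have U: "U \<in> hom (unit_obj \<otimes>\<^sub>o unit_obj) (dom p \<otimes>\<^sub>o unit_obj)"
    using fin u0 by (intro homI) (auto simp: U_def unit_obj_def split: point.splits)
  have V: "V \<in> hom (C \<otimes>\<^sub>o unit_obj) (cod p \<otimes>\<^sub>o unit_obj)"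
    using fin v0 by (intro homI) (auto simp: V_def unit_obj_def split: point.splits)
  have \<mu>: "\<mu> C \<in> hom unit_obj C"
    using fin by (simp add: mixed_hom)
  have I: "?I \<in> hom unit_obj unit_obj"
    by (simp add: ident_hom)
  have S: "Star \<in> unit_obj"
    by (simp add: unit_obj_def)
  have "(p \<otimes> ?I) \<cdot> U = V \<cdot> (\<mu> C \<otimes> ?I)"
  proof (rule morphism_eqI)
    show "(p \<otimes> ?I) \<cdot> U \<in> hom (unit_obj \<otimes>\<^sub>o unit_obj) (cod p \<otimes>\<^sub>o unit_obj)"
      using U tensor_hom[OF p' I] by (rule comp_hom)
    show "V \<cdot> (\<mu> C \<otimes> ?I) \<in> hom (unit_obj \<otimes>\<^sub>o unit_obj) (cod p \<otimes>\<^sub>o unit_obj)"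
      using tensor_hom[OF \<mu> I] V by (rule comp_hom)
    fix y x
    assume "y \<in> cod p \<otimes>\<^sub>o unit_obj" "x \<in> unit_obj \<otimes>\<^sub>o (unit_obj :: 'a point set)"
    then obtain d where d: "y = Tup d Star" "d \<in> cod p" and x: "x = Tup Star Star"
      by (auto simp: tensor_obj_def unit_obj_def)
    show "entry ((p \<otimes> ?I) \<cdot> U) y x = entry (V \<cdot> (\<mu> C \<otimes> ?I)) y x"
      unfolding d(1) x entry_tensor_ident_comp[OF p' U S] entry_comp_tensor_ident[OF \<mu> V S]
      using uv d(2) by (auto simp: U_def V_def mixed_state_def S)
  qed
  then obtain h where h: "h \<in> hom (C \<otimes>\<^sub>o unit_obj) (dom p \<otimes>\<^sub>o unit_obj)"
    and hU: "h \<cdot> (\<mu> C \<otimes> ?I) = U" and hV: "(p \<otimes> ?I) \<cdot> h = V"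
    using l U V unfolding lifts_def by fastforce
  show "\<exists>h. (\<forall>c x. 0 \<le> h c x) \<and> (\<forall>x\<in>dom p. (\<Sum>c\<in>C. h c x) = u x) \<and>
        (\<forall>c\<in>C. \<forall>d\<in>cod p. (\<Sum>x\<in>dom p. entry p d x * h c x) = v c d)"
  proof (intro exI conjI allI ballI)
    fix c x
    show "0 \<le> entry h (Tup x Star) (Tup c Star)"
      using h by (rule homD)
  next
    fix x
    assume "x \<in> dom p"
    then show "(\<Sum>c\<in>C. entry h (Tup x Star) (Tup c Star)) = u x"
      using arg_cong[OF hU, of "\<lambda>f. entry f (Tup x Star) (Tup Star Star)"]
      unfolding entry_comp_tensor_ident[OF \<mu> h S] by (simp add: U_def mixed_state_def S)
  next
    fix c d
    assume "c \<in> C" "d \<in> cod p"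
    then show "(\<Sum>x\<in>dom p. entry p d x * entry h (Tup x Star) (Tup c Star)) = v c d"
      using arg_cong[OF hV, of "\<lambda>f. entry f (Tup d Star) (Tup c Star)"]
      unfolding entry_tensor_ident_comp[OF p' h S] by (simp add: V_def)
  qed
qed

text \<open>For fixed \<open>x\<close>, \<open>a\<close>, \<open>b\<close> the square says that
  column \<open>x\<close> of \<open>u\<close> has an image under \<open>p\<close> decomposed along
  the fibre over \<open>x\<close>. Every \<open>y\<close> lies in exactly one fibre, so solutions
  found separately glue to a single diagonal.\<close>

lemma fibre_matrix_monoidal_lifts:
  assumes fin: "finite X" "finite Y" and \<pi>: "\<And>y. y \<in> Y \<Longrightarrow> \<pi> y \<in> X"
    and fib: "\<And>x. x \<in> X \<Longrightarrow> {y \<in> Y. \<pi> y = x} \<in> \<S>"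
    and "p \<in> FStoch" and dec: "lifts_decompositions \<S> p"
  shows "fibre_matrix X Y \<pi> \<oslash> p"
  unfolding monoidal_lifts_def
proof (intro ballI)
  fix A B :: "'a point set"
  assume "A \<in> finite_sets" "B \<in> finite_sets"
  then have AB: "finite A" "finite B" by simp_all
  define l where "l = fibre_matrix X Y \<pi>"
  have l: "l \<in> hom X Y" unfolding l_def by (rule fibre_matrix_hom[OF fin])
  have p: "p \<in> hom (dom p) (cod p)" using \<open>p \<in> FStoch\<close> by (rule FStoch_hom)
  note iA = ident_hom[OF AB(1)] and iB = ident_hom[OF AB(2)]
  have sum_l: "(\<Sum>y\<in>Y. g y * entry l y x) = (\<Sum>y\<in>{y \<in> Y. \<pi> y = x}. g y)"
    if "x \<in> X" for g x
    unfolding l_def using fin(2) that by (rule sum_fibre_matrix)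
  have "\<exists>h\<in>hom (Y \<otimes>\<^sub>o A) (dom p \<otimes>\<^sub>o B). h \<cdot> (l \<otimes> ident A) = u \<and> (p \<otimes> ident B) \<cdot> h = v"
    if u: "u \<in> hom (X \<otimes>\<^sub>o A) (dom p \<otimes>\<^sub>o B)" and v: "v \<in> hom (Y \<otimes>\<^sub>o A) (cod p \<otimes>\<^sub>o B)"
      and eq: "(p \<otimes> ident B) \<cdot> u = v \<cdot> (l \<otimes> ident A)" for u v
  proof -
    \<comment> \<open>\<open>Q x a b h\<close>: the family \<open>h\<close> solves the problem at
      \<open>x\<close>, \<open>a\<close>, \<open>b\<close>. A solution exists by \<open>dec\<close>,
      with the fibre over \<open>x\<close> as the indexing object.\<close>
    define Q where "Q x a b h \<longleftrightarrow> (\<forall>y c. 0 \<le> h y c) \<and>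
        (\<forall>c\<in>dom p. (\<Sum>y\<in>{y \<in> Y. \<pi> y = x}. h y c) = entry u (Tup c b) (Tup x a)) \<and>
        (\<forall>y\<in>{y \<in> Y. \<pi> y = x}. \<forall>d\<in>cod p.
          (\<Sum>c\<in>dom p. entry p d c * h y c) = entry v (Tup d b) (Tup y a))" for x a b h
    have ex: "\<exists>h. Q x a b h" if "x \<in> X" "a \<in> A" "b \<in> B" for x a b
      unfolding Q_def
    proof (rule dec[unfolded lifts_decompositions_def, rule_format], use that in \<open>simp add: fib\<close>,
        intro conjI allI ballI)
      fix d
      assume "d \<in> cod p"
      have "entry ((p \<otimes> ident B) \<cdot> u) (Tup d b) (Tup x a)
          = entry (v \<cdot> (l \<otimes> ident A)) (Tup d b) (Tup x a)"
        by (simp add: eq)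
      then show "(\<Sum>c\<in>dom p. entry p d c * entry u (Tup c b) (Tup x a))
          = (\<Sum>y\<in>{y \<in> Y. \<pi> y = x}. entry v (Tup d b) (Tup y a))"
        unfolding entry_tensor_ident_comp[OF p u \<open>b \<in> B\<close>] entry_comp_tensor_ident[OF l v \<open>a \<in> A\<close>]
          sum_l[OF \<open>x \<in> X\<close>] .
    qed (use u v in \<open>auto simp: homD\<close>)
    define H where "H x a b = (SOME h. Q x a b h)" for x a b
    have H: "Q x a b (H x a b)" if "x \<in> X" "a \<in> A" "b \<in> B" for x a b
      unfolding H_def using ex[OF that] by (rule someI_ex)
    have H0: "0 \<le> H x a b y c" if "x \<in> X" "a \<in> A" "b \<in> B" for x a b y c
      using H[OF that] by (simp add: Q_def)
    have Hu: "(\<Sum>y\<in>{y \<in> Y. \<pi> y = x}. H x a b y c) = entry u (Tup c b) (Tup x a)"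
      if "x \<in> X" "a \<in> A" "b \<in> B" "c \<in> dom p" for x a b c
      using H[OF that(1-3)] that(4) by (simp add: Q_def)
    have Hv: "(\<Sum>c\<in>dom p. entry p d c * H (\<pi> y) a b y c) = entry v (Tup d b) (Tup y a)"
      if "a \<in> A" "b \<in> B" "y \<in> Y" "d \<in> cod p" for a b y d
      using H[OF \<pi>[OF that(3)] that(1,2)] that(3,4) by (simp add: Q_def)
    \<comment> \<open>Gluing: at \<open>y\<close> use the solution belonging to the fibre that
      contains \<open>y\<close>, namely the one over \<open>\<pi> y\<close>.\<close>
    define h where "h = \<lparr>dom = Y \<otimes>\<^sub>o A, cod = dom p \<otimes>\<^sub>o B,
      entry = (\<lambda>z w. case (z, w) of (Tup c b, Tup y a) \<Rightarrow>
        if c \<in> dom p \<and> b \<in> B \<and> y \<in> Y \<and> a \<in> A then H (\<pi> y) a b y c else 0 | _ \<Rightarrow> 0)\<rparr>"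
    have h: "h \<in> hom (Y \<otimes>\<^sub>o A) (dom p \<otimes>\<^sub>o B)"
      using fin AB homD(3)[OF p] H0 \<pi> by (intro homI) (auto simp: h_def split: point.splits)
    have "h \<cdot> (l \<otimes> ident A) = u"
    proof (rule morphism_eqI[OF comp_hom[OF tensor_hom[OF l iA] h] u])
      fix z w
      assume "z \<in> dom p \<otimes>\<^sub>o B" "w \<in> X \<otimes>\<^sub>o A"
      then obtain c b x a where zw: "z = Tup c b" "c \<in> dom p" "b \<in> B" "w = Tup x a" "x \<in> X" "a \<in> A"
        by (auto elim!: tensor_objE)
      have "entry (h \<cdot> (l \<otimes> ident A)) z w
          = (\<Sum>y\<in>{y \<in> Y. \<pi> y = x}. entry h (Tup c b) (Tup y a))"
        unfolding zw entry_comp_tensor_ident[OF l h \<open>a \<in> A\<close>] sum_l[OF \<open>x \<in> X\<close>] ..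
      also have "\<dots> = (\<Sum>y\<in>{y \<in> Y. \<pi> y = x}. H x a b y c)"
        using zw by (intro sum.cong) (auto simp: h_def)
      finally show "entry (h \<cdot> (l \<otimes> ident A)) z w = entry u z w"
        using Hu zw by simp
    qed
    moreover have "(p \<otimes> ident B) \<cdot> h = v"
    proof (rule morphism_eqI[OF comp_hom[OF h tensor_hom[OF p iB]] v])
      fix z w
      assume "z \<in> cod p \<otimes>\<^sub>o B" "w \<in> Y \<otimes>\<^sub>o A"
      then obtain d b y a where zw: "z = Tup d b" "d \<in> cod p" "b \<in> B" "w = Tup y a" "y \<in> Y" "a \<in> A"
        by (auto elim!: tensor_objE)
      show "entry ((p \<otimes> ident B) \<cdot> h) z w = entry v z w"
        unfolding zw entry_tensor_ident_comp[OF p h \<open>b \<in> B\<close>]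
        using Hv[of a b y d] zw by (simp add: h_def)
    qed
    ultimately show ?thesis
      using h by blast
  qed
  then show "lifts (fibre_matrix X Y \<pi> \<otimes> ident A) (p \<otimes> ident B)"
    unfolding lifts_def l_def[symmetric] by (simp add: homD[OF l])
qed

section \<open>Pure and mixing morphisms\<close>

lemma mixed_state_fibre_matrix: "\<mu> A = fibre_matrix unit_obj A (\<lambda>_. Star)"
  by (auto simp: mixed_state_def fibre_matrix_def unit_obj_def fun_eq_iff)

text \<open>It suffices to test purity with unit auxiliary objects. For the converse, \<mu> is the
  fibre matrix of the map to a point, whose only fibre is the whole object.\<close>

lemma pure_iff:
  assumes "\<S> \<subseteq> finite_sets"
  shows "p \<in> pure \<S> \<longleftrightarrow> p \<in> FStoch \<and> lifts_decompositions \<S> p"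
proof
  assume "p \<in> pure \<S>"
  then show "p \<in> FStoch \<and> lifts_decompositions \<S> p"
    using pure_lifts_decompositions[OF assms] by (simp add: pure_def right_class_def)
next
  assume p: "p \<in> FStoch \<and> lifts_decompositions \<S> p"
  have "\<mu> A \<oslash> p" if "A \<in> \<S>" for A
    unfolding mixed_state_fibre_matrix
  proof (rule fibre_matrix_monoidal_lifts)
    show "{y \<in> A. Star = x} \<in> \<S>" if "x \<in> unit_obj" for x :: "'a point"
      using that \<open>A \<in> \<S>\<close> by (simp add: unit_obj_def)
  qed (use p \<open>A \<in> \<S>\<close> assms in \<open>auto simp: unit_obj_def\<close>)
  with p show "p \<in> pure \<S>"
    by (auto simp: pure_def right_class_def)
qed

lemma fibre_matrix_mixing:
  assumes "\<S> \<subseteq> finite_sets" "finite X" "finite Y" "\<And>y. y \<in> Y \<Longrightarrow> \<pi> y \<in> X"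
    and "\<And>x. x \<in> X \<Longrightarrow> {y \<in> Y. \<pi> y = x} \<in> \<S>"
  shows "fibre_matrix X Y \<pi> \<in> mixing \<S>"
  unfolding mixing_def left_class_def
  using assms fibre_matrix_monoidal_lifts[of X Y \<pi> \<S>] fibre_matrix_hom[of X Y \<pi>]
  by (auto simp: pure_iff homD)

text \<open>Column \<open>x\<close> contributes to row \<open>\<phi> x\<close> only, so
  \<open>u x\<close> can be split in the ratios \<open>v c (\<phi> x) / T (\<phi> x)\<close>, where
  \<open>T\<close> is the image of \<open>u\<close> under \<open>p\<close>. If \<open>{}\<close> is
  in \<S>, a zero column would leave \<open>u x\<close> free although the empty sum has to equal it;
  hence the last assumption.\<close>

lemma pureI:
  assumes \<S>: "\<S> \<subseteq> finite_sets" and "p \<in> FStoch"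
    and mono: "\<And>x y. x \<in> dom p \<Longrightarrow> y \<noteq> \<phi> x \<Longrightarrow> entry p y x = 0"
    and nz: "{} \<in> \<S> \<Longrightarrow> (\<And>x. x \<in> dom p \<Longrightarrow> entry p (\<phi> x) x \<noteq> 0)"
  shows "p \<in> pure \<S>"
proof -
  have p: "p \<in> hom (dom p) (cod p)" using \<open>p \<in> FStoch\<close> by (rule FStoch_hom)
  have "lifts_decompositions \<S> p"
    unfolding lifts_decompositions_def
  proof (intro ballI allI impI, elim conjE)
    fix C and u :: "'a point \<Rightarrow> real" and v :: "'a point \<Rightarrow> 'a point \<Rightarrow> real"
    assume C: "C \<in> \<S>" and u0: "\<forall>x. 0 \<le> u x" and v0: "\<forall>c d. 0 \<le> v c d"
    define T where "T d = (\<Sum>x\<in>dom p. entry p d x * u x)" for d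
    assume "\<forall>d\<in>cod p. (\<Sum>x\<in>dom p. entry p d x * u x) = (\<Sum>c\<in>C. v c d)"
    then have T: "T d = (\<Sum>c\<in>C. v c d)" if "d \<in> cod p" for d
      using that by (simp add: T_def)
    have finC: "finite C" using C \<S> by auto
    have T0: "0 \<le> T d" for d
      unfolding T_def using u0 homD(5)[OF p] by (intro sum_nonneg) auto
    have T_eq_0: "entry p d x * u x = 0" if "T d = 0" "x \<in> dom p" for d x
    proof -
      have "\<forall>x\<in>dom p. entry p d x * u x = 0"
        using that(1) u0 homD(3,5)[OF p] unfolding T_def
        by (subst (asm) sum_nonneg_eq_0_iff) auto
      then show ?thesis using that(2) by blast
    qed
    define c0 where "c0 = (SOME c. c \<in> C)"
    have c0: "c0 \<in> C" if "C \<noteq> {}"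
      using that unfolding c0_def by (simp add: some_in_eq)
    \<comment> \<open>Where the ratio is undefined or the column is zero, all of \<open>u x\<close>
      goes to the single index \<open>c0\<close>. There
      \<open>entry p (\<phi> x) x * u x = 0\<close>, so the image under \<open>p\<close> is
      unaffected.\<close>
    define h where "h c x = (if T (\<phi> x) = 0 \<or> entry p (\<phi> x) x = 0
      then (if c = c0 then u x else 0) else u x * v c (\<phi> x) / T (\<phi> x))" for c x
    have cod: "d \<in> cod p" if "entry p d x \<noteq> 0" for d x
      using that homD(6)[OF p] by blast
    show "\<exists>h. (\<forall>c x. 0 \<le> h c x) \<and> (\<forall>x\<in>dom p. (\<Sum>c\<in>C. h c x) = u x) \<and>
        (\<forall>c\<in>C. \<forall>d\<in>cod p. (\<Sum>x\<in>dom p. entry p d x * h c x) = v c d)"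
    proof (intro exI conjI allI ballI)
      show "0 \<le> h c x" for c x
        using u0 v0 T0 by (simp add: h_def)
    next
      fix x
      assume x: "x \<in> dom p"
      show "(\<Sum>c\<in>C. h c x) = u x"
      proof (cases "C = {}")
        case True
        \<comment> \<open>An empty decomposition forces \<open>T (\<phi> x) = 0\<close>, and the
          nonzero entry turns this into \<open>u x = 0\<close>.\<close>
        then have "entry p (\<phi> x) x \<noteq> 0" using C nz x by blast
        moreover from this have "T (\<phi> x) = 0" using T cod True by simp
        ultimately have "u x = 0" using T_eq_0 x by fastforce
        then show ?thesis using True by simp
      next
        case False
        show ?thesis
        proof (cases "T (\<phi> x) = 0 \<or> entry p (\<phi> x) x = 0")
          case True
          then show ?thesis using c0[OF False] finC by (simp add: h_def)
        next
          case F: False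
          then have "(\<Sum>c\<in>C. h c x) = (\<Sum>c\<in>C. u x * v c (\<phi> x) / T (\<phi> x))"
            by (simp add: h_def)
          also have "\<dots> = u x * (\<Sum>c\<in>C. v c (\<phi> x)) / T (\<phi> x)"
            by (simp add: sum_distrib_left sum_divide_distrib)
          also have "\<dots> = u x"
            using F T[OF cod, of "\<phi> x" x] by simp
          finally show ?thesis .
        qed
      qed
    next
      fix c d
      assume c: "c \<in> C" and d: "d \<in> cod p"
      show "(\<Sum>x\<in>dom p. entry p d x * h c x) = v c d"
      proof (cases "T d = 0")
        case True
        then have "(\<Sum>c\<in>C. v c d) = 0" using T d by simp
        then have "v c d = 0" using v0 finC c by (simp add: sum_nonneg_eq_0_iff)
        moreover have "entry p d x * h c x = 0" if "x \<in> dom p" for x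
          using T_eq_0[OF True that] mono[OF that, of d] True by (cases "d = \<phi> x") (auto simp: h_def)
        ultimately show ?thesis by (metis (mono_tags, lifting) sum.neutral)
      next
        case False
        \<comment> \<open>The ratio \<open>v c d / T d\<close> is the same for all columns that
          reach row \<open>d\<close>, so it factors out of the sum.\<close>
        have "entry p d x * h c x = entry p d x * u x * (v c d / T d)" if "x \<in> dom p" for x
          using False mono[OF that, of d] by (cases "d = \<phi> x") (auto simp: h_def)
        then have "(\<Sum>x\<in>dom p. entry p d x * h c x)
            = (\<Sum>x\<in>dom p. entry p d x * u x * (v c d / T d))"
          by (rule sum.cong[OF refl])
        also have "\<dots> = T d * (v c d / T d)"
          unfolding T_def by (rule sum_distrib_right[symmetric])
        finally have "(\<Sum>x\<in>dom p. entry p d x * h c x) = T d * (v c d / T d)" .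
        then show ?thesis using False by simp
      qed
    qed
  qed
  then show ?thesis
    using \<open>p \<in> FStoch\<close> \<S> by (simp add: pure_iff)
qed

section \<open>Factorisation through a set of pairs\<close>

fun tfst :: "'a point \<Rightarrow> 'a point" where
  "tfst (Tup a c) = a"
| "tfst z = z"

fun tsnd :: "'a point \<Rightarrow> 'a point" where
  "tsnd (Tup a c) = c"
| "tsnd z = z"

text \<open>The column of a pair \<open>(a, b)\<close> carries the weight \<open>f b a\<close> in
  row \<open>b\<close> and nothing else: storing the output in the pair gives columns with at most
  one nonzero entry, as \<open>pureI\<close> demands with \<open>tsnd\<close> for \<phi>.\<close>

definition pair_matrix :: "'a morphism \<Rightarrow> 'a point set \<Rightarrow> 'a morphism"
  where "pair_matrix f Y = \<lparr>dom = Y, cod = cod f,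
    entry = (\<lambda>b z. if z \<in> Y \<and> tsnd z = b then entry f b (tfst z) else 0)\<rparr>"

lemma pair_matrix_hom: "f \<in> hom A B \<Longrightarrow> finite Y \<Longrightarrow> pair_matrix f Y \<in> hom Y B"
  by (rule homI) (auto simp: pair_matrix_def homD)

lemma pair_matrix_pure:
  assumes "\<S> \<subseteq> finite_sets" "f \<in> hom A B" "finite Y"
    and "{} \<in> \<S> \<Longrightarrow> (\<And>z. z \<in> Y \<Longrightarrow> entry f (tsnd z) (tfst z) \<noteq> 0)"
  shows "pair_matrix f Y \<in> pure \<S>"
  using assms homD(7)[OF pair_matrix_hom[OF assms(2,3)]]
  by (intro pureI[where \<phi> = tsnd]) (auto simp: pair_matrix_def)

lemma pair_matrix_factorisation:
  assumes f: "f \<in> hom A B" and Y: "finite Y" "Y \<subseteq> A \<otimes>\<^sub>o C"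
    and supp: "\<And>a b. entry f b a \<noteq> 0 \<Longrightarrow> Tup a b \<in> Y"
  shows "f = pair_matrix f Y \<cdot> fibre_matrix A Y tfst"
proof (rule morphism_eqI[OF f comp_hom[OF fibre_matrix_hom pair_matrix_hom[OF f]]])
  fix b a
  assume ab: "b \<in> B" "a \<in> A"
  have "entry (pair_matrix f Y \<cdot> fibre_matrix A Y tfst) b a
      = (\<Sum>z\<in>Y. entry (pair_matrix f Y) b z * entry (fibre_matrix A Y tfst) z a)"
    by (simp add: comp_def fibre_matrix_def)
  also have "\<dots> = (\<Sum>z\<in>{z \<in> Y. tfst z = a}. entry (pair_matrix f Y) b z)"
    using Y(1) ab(2) by (rule sum_fibre_matrix)
  also have "\<dots> = (\<Sum>z\<in>{z \<in> Y. tfst z = a}. if z = Tup a b then entry f b a else 0)"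
    using Y(2) by (intro sum.cong) (auto simp: pair_matrix_def elim!: tensor_objE)
  \<comment> \<open>If the pair is missing from \<open>Y\<close>, the sum is 0, and so is
    \<open>f b a\<close> by \<open>supp\<close>.\<close>
  also have "\<dots> = entry f b a"
    using Y(1) supp[of b a] by (auto)
  finally show "entry f b a = entry (pair_matrix f Y \<cdot> fibre_matrix A Y tfst) b a" ..
qed (use f Y in \<open>auto simp: homD\<close>)

text \<open>Identifies the map in the definition of purification with the fibre matrix of a full
  product, so that \<open>pair_matrix_factorisation\<close> yields purifications.\<close>

lemma ident_tensor_mixed_state:
  assumes "finite A" "finite C"
  shows "(ident A \<otimes> \<mu> C) \<cdot> runit_inv A = fibre_matrix A (A \<otimes>\<^sub>o C) tfst"
proof (rule morphism_eqI)
  show "(ident A \<otimes> \<mu> C) \<cdot> runit_inv A \<in> hom A (A \<otimes>\<^sub>o C)"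
    using assms by (intro comp_hom[OF runit_inv_hom tensor_hom] ident_hom mixed_hom)
  show "fibre_matrix A (A \<otimes>\<^sub>o C) tfst \<in> hom A (A \<otimes>\<^sub>o C)"
    using assms by (intro fibre_matrix_hom) auto
  fix z x
  assume "z \<in> A \<otimes>\<^sub>o C" and x: "x \<in> A"
  then obtain a c where z: "z = Tup a c" "a \<in> A" "c \<in> C"
    by (auto elim: tensor_objE)
  have "entry ((ident A \<otimes> \<mu> C) \<cdot> runit_inv A) z x
      = (\<Sum>w\<in>A \<otimes>\<^sub>o unit_obj. if w = Tup x Star then entry (ident A \<otimes> \<mu> C) z w else 0)"
    using x by (simp add: comp_def runit_inv_def) (intro sum.cong, auto)
  also have "\<dots> = entry (ident A \<otimes> \<mu> C) z (Tup x Star)"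
    using x assms(1) by (simp add: unit_obj_def)
  also have "\<dots> = entry (fibre_matrix A (A \<otimes>\<^sub>o C) tfst) z x"
    using x z by (auto simp: entry_ident mixed_state_def unit_obj_def fibre_matrix_def)
  finally show "entry ((ident A \<otimes> \<mu> C) \<cdot> runit_inv A) z x
      = entry (fibre_matrix A (A \<otimes>\<^sub>o C) tfst) z x" .
qed

section \<open>Purification\<close>

lemma has_purification_nonempty: "has_purification nonempty_finite_sets"
  unfolding has_purification_def
proof (intro ballI)
  fix A B and f :: "'a morphism"
  assume "A \<in> finite_sets" "B \<in> finite_sets" and f: "f \<in> hom A B"
  then have fin: "finite A" "finite B" by simp_all
  \<comment> \<open>The point \<open>Star\<close> only serves to make \<open>C\<close> nonempty when \<open>B\<close> is empty.\<close>
  define C where "C = insert Star B"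
  have C: "finite C" "C \<in> nonempty_finite_sets"
    using fin by (auto simp: C_def nonempty_finite_sets_def)
  let ?p = "pair_matrix f (A \<otimes>\<^sub>o C)"
  have "f = ?p \<cdot> fibre_matrix A (A \<otimes>\<^sub>o C) tfst"
    using fin C homD(6)[OF f] by (intro pair_matrix_factorisation[OF f]) (auto simp: C_def)
  \<comment> \<open>Pairs outside the support of \<open>f\<close> give zero columns, which are
    allowed because \<open>{}\<close> is not among the distinguished objects.\<close>
  moreover have "?p \<in> pure nonempty_finite_sets"
    using fin C f by (intro pair_matrix_pure) (auto simp: nonempty_finite_sets_def)
  moreover have "?p \<in> hom (A \<otimes>\<^sub>o C) B"
    using fin C f by (intro pair_matrix_hom) auto
  ultimately show "\<exists>C \<in> nonempty_finite_sets. \<exists>p \<in> hom (A \<otimes>\<^sub>o C) B. p \<in> pure nonempty_finite_sets \<and>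
      f = p \<cdot> (ident A \<otimes> \<mu> C) \<cdot> runit_inv A"
    unfolding ident_tensor_mixed_state[OF fin(1) C(1), symmetric] using C(2) by blast
qed

section \<open>Weak factorisation systems\<close>

text \<open>The two classes form a Galois connection, so three applications equal one;
  \<open>\<A> \<subseteq> FStoch\<close> puts \<A> inside its own closure.\<close>

lemma right_left_right_class:
  "\<A> \<subseteq> FStoch \<Longrightarrow> right_class (left_class (right_class \<A>)) = right_class \<A>"
  by (auto simp: right_class_def left_class_def)

text \<open>Purification fails for \<open>finite_sets\<close>, so it cannot supply this
  factorisation for both choices of \<S>. Here the fibres may vary with the point \<open>a\<close>;
  they only have to lie in \<S>.\<close>

lemma mixing_pure_factorisation:
  assumes \<S>: "\<S> \<in> {finite_sets, nonempty_finite_sets}" and "f \<in> FStoch"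
  shows "\<exists>l\<in>mixing \<S>. \<exists>r\<in>pure \<S>. cod l = dom r \<and> f = r \<cdot> l"
proof -
  define A B where "A = dom f" and "B = cod f"
  have f: "f \<in> hom A B" using \<open>f \<in> FStoch\<close> by (simp add: A_def B_def FStoch_hom)
  have sub: "\<S> \<subseteq> finite_sets" using \<S> by (auto simp: nonempty_finite_sets_def)
  \<comment> \<open>The support avoids zero columns, but may have empty fibres, which only
    \<open>finite_sets\<close> admits. The full product has nonempty fibres, thanks to
    \<open>Star\<close> even for empty \<open>B\<close>.\<close>
  define Y where "Y = (if \<S> = finite_sets then {Tup a b | a b. entry f b a \<noteq> 0}
    else A \<otimes>\<^sub>o insert Star B)"
  have supp: "Tup a b \<in> A \<otimes>\<^sub>o B" if "entry f b a \<noteq> 0" for a b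
    using that homD(6)[OF f] by fastforce
  then have YA: "Y \<subseteq> A \<otimes>\<^sub>o insert Star B" by (auto simp: Y_def elim!: tensor_objE)
  then have Y: "finite Y" by (rule finite_subset) (use f in \<open>auto simp: homD\<close>)
  have ne: "\<S> = finite_sets" if "{} \<in> \<S>"
    using \<S> that by (auto simp: nonempty_finite_sets_def)
  have fib: "{z \<in> Y. tfst z = a} \<in> \<S>" if "a \<in> A" for a
  proof (cases "\<S> = finite_sets")
    case True
    then show ?thesis using Y by simp
  next
    case False
    then have "Tup a Star \<in> {z \<in> Y. tfst z = a}" using that by (simp add: Y_def)
    then show ?thesis using Y \<S> False by (auto simp: nonempty_finite_sets_def)
  qed
  have "fibre_matrix A Y tfst \<in> mixing \<S>"
    using sub f Y YA fib by (intro fibre_matrix_mixing) (auto simp: homD elim!: tensor_objE)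
  moreover have "pair_matrix f Y \<in> pure \<S>"
    using sub f Y ne by (intro pair_matrix_pure) (auto simp: Y_def)
  moreover have "f = pair_matrix f Y \<cdot> fibre_matrix A Y tfst"
    using supp by (intro pair_matrix_factorisation[OF f Y YA]) (auto simp: Y_def)
  moreover have "cod (fibre_matrix A Y tfst) = dom (pair_matrix f Y)"
    by (simp add: fibre_matrix_def pair_matrix_def)
  ultimately show ?thesis by blast
qed

lemma mixing_pure_wfs:
  assumes "\<S> \<in> {finite_sets, nonempty_finite_sets}"
  shows "monoidal_wfs (mixing \<S>) (pure \<S>)"
proof -
  have "\<mu> ` \<S> \<subseteq> FStoch"
    using assms mixed_hom by (fastforce simp: nonempty_finite_sets_def dest: homD(7))
  then have "pure \<S> = right_class (mixing \<S>)"
    by (simp add: mixing_def pure_def right_left_right_class)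
  then show ?thesis
    using mixing_pure_factorisation[OF assms] unfolding monoidal_wfs_def mixing_def by blast
qed

section \<open>Transposition\<close>

definition transpose_mat :: "'a morphism \<Rightarrow> 'a morphism"
  where "transpose_mat f = \<lparr>dom = cod f, cod = dom f, entry = (\<lambda>y x. entry f x y)\<rparr>"

lemma transpose_transpose [simp]: "transpose_mat (transpose_mat f) = f"
  by (simp add: transpose_mat_def)

lemma dom_transpose [simp]: "dom (transpose_mat f) = cod f"
  and cod_transpose [simp]: "cod (transpose_mat f) = dom f"
  by (simp_all add: transpose_mat_def)

lemma transpose_hom_iff [simp]: "transpose_mat f \<in> hom A B \<longleftrightarrow> f \<in> hom B A"
  by (auto simp: hom_def FStoch_def transpose_mat_def)

lemma transpose_FStoch_iff [simp]: "transpose_mat f \<in> FStoch \<longleftrightarrow> f \<in> FStoch"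
  by (auto simp: FStoch_def transpose_mat_def)

lemma transpose_comp: "cod f = dom g \<Longrightarrow> transpose_mat (g \<cdot> f) = transpose_mat f \<cdot> transpose_mat g"
  by (simp add: transpose_mat_def comp_def mult.commute)

lemma transpose_tensor: "transpose_mat (f \<otimes> g) = transpose_mat f \<otimes> transpose_mat g"
  by (auto simp: transpose_mat_def tensor_def fun_eq_iff split: point.splits)

lemma transpose_ident [simp]: "transpose_mat (ident A) = ident A"
  by (auto simp: transpose_mat_def ident_def fun_eq_iff)

lemma transpose_mixed_state [simp]: "transpose_mat (\<mu> A) = \<epsilon> A"
  by (auto simp: transpose_mat_def mixed_state_def discard_effect_def fun_eq_iff)

text \<open>Transposition reverses composition, so it turns a square around, with \<open>u\<close>
  and \<open>v\<close> changing places, and carries a diagonal to a diagonal.\<close>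

lemma lifts_transpose:
  assumes l: "lifts f g"
  shows "lifts (transpose_mat g) (transpose_mat f)"
  unfolding lifts_def
proof (intro ballI impI)
  fix u v
  assume u: "u \<in> hom (dom (transpose_mat g)) (dom (transpose_mat f))"
    and v: "v \<in> hom (cod (transpose_mat g)) (cod (transpose_mat f))"
    and eq: "transpose_mat f \<cdot> u = v \<cdot> transpose_mat g"
  have "g \<cdot> transpose_mat v = transpose_mat u \<cdot> f"
    using arg_cong[OF eq, of transpose_mat] u v by (simp add: transpose_comp homD)
  then obtain h where "h \<in> hom (cod f) (dom g)" "h \<cdot> f = transpose_mat v" "g \<cdot> h = transpose_mat u"
    using l u v by (fastforce simp: lifts_def)
  then have "transpose_mat h \<in> hom (cod (transpose_mat g)) (dom (transpose_mat f))"
    "transpose_mat h \<cdot> transpose_mat g = u" "transpose_mat f \<cdot> transpose_mat h = v"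
    by (simp_all add: homD flip: transpose_comp)
  then show "\<exists>h\<in>hom (cod (transpose_mat g)) (dom (transpose_mat f)). h \<cdot> transpose_mat g = u \<and> transpose_mat f \<cdot> h = v"
    by blast
qed

lemma monoidal_lifts_transpose: "f \<oslash> g \<Longrightarrow> transpose_mat g \<oslash> transpose_mat f"
  unfolding monoidal_lifts_def by (metis lifts_transpose transpose_tensor transpose_ident)

lemma monoidal_lifts_transpose_left: "transpose_mat g \<oslash> f \<longleftrightarrow> transpose_mat f \<oslash> g"
  using monoidal_lifts_transpose[of "transpose_mat g" f] monoidal_lifts_transpose[of "transpose_mat f" g]
  by auto

lemma monoidal_lifts_transpose_right: "f \<oslash> transpose_mat g \<longleftrightarrow> g \<oslash> transpose_mat f"
  using monoidal_lifts_transpose[of f "transpose_mat g"] monoidal_lifts_transpose[of g "transpose_mat f"]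
  by auto

lemma in_transpose_image_iff: "f \<in> transpose_mat ` \<A> \<longleftrightarrow> transpose_mat f \<in> \<A>"
  by (metis imageE image_eqI transpose_transpose)

lemma left_class_transpose: "left_class (transpose_mat ` \<A>) = transpose_mat ` right_class \<A>"
  by (rule set_eqI)
    (simp add: left_class_def right_class_def in_transpose_image_iff monoidal_lifts_transpose_right)

lemma right_class_transpose: "right_class (transpose_mat ` \<A>) = transpose_mat ` left_class \<A>"
  by (rule set_eqI)
    (simp add: left_class_def right_class_def in_transpose_image_iff monoidal_lifts_transpose_left)

text \<open>\<epsilon> is the transpose of \<mu>, and transposition exchanges left and right lifting
  classes.\<close>

lemma copure_eq: "copure \<S> = transpose_mat ` pure \<S>"
proof -
  have "\<epsilon> ` \<S> = transpose_mat ` \<mu> ` \<S>"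
    by (simp add: image_image)
  then show ?thesis
    by (simp only: copure_def pure_def left_class_transpose)
qed

lemma discarding_eq: "discarding \<S> = transpose_mat ` mixing \<S>"
  by (simp add: discarding_def mixing_def copure_eq right_class_transpose)

lemma monoidal_wfs_transpose:
  assumes "monoidal_wfs \<L> \<R>"
  shows "monoidal_wfs (transpose_mat ` \<R>) (transpose_mat ` \<L>)"
proof -
  have wfs: "\<forall>f\<in>FStoch. \<exists>l\<in>\<L>. \<exists>r\<in>\<R>. cod l = dom r \<and> f = r \<cdot> l"
    "\<L> = left_class \<R>" "\<R> = right_class \<L>"
    using assms unfolding monoidal_wfs_def by - (elim conjE, assumption)+
  have "\<exists>l\<in>transpose_mat ` \<R>. \<exists>r\<in>transpose_mat ` \<L>. cod l = dom r \<and> f = r \<cdot> l"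
    if f: "f \<in> FStoch" for f
  proof -
    obtain l r where lr: "l \<in> \<L>" "r \<in> \<R>" "cod l = dom r" "transpose_mat f = r \<cdot> l"
      using wfs(1)[rule_format, of "transpose_mat f"] f by auto
    have "f = transpose_mat (r \<cdot> l)"
      by (simp flip: lr(4))
    then have "f = transpose_mat l \<cdot> transpose_mat r"
      by (simp add: transpose_comp lr(3))
    moreover have "cod (transpose_mat r) = dom (transpose_mat l)"
      by (simp add: lr(3))
    ultimately show ?thesis
      using lr(1,2) by blast
  qed
  moreover have "transpose_mat ` \<R> = left_class (transpose_mat ` \<L>)"
    "transpose_mat ` \<L> = right_class (transpose_mat ` \<R>)"
    unfolding left_class_transpose right_class_transpose
    by (simp_all only: wfs(2,3)[symmetric])
  ultimately show ?thesis
    unfolding monoidal_wfs_def by blast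
qed

lemma copure_discarding_wfs:
  assumes "\<S> \<in> {finite_sets, nonempty_finite_sets}"
  shows "monoidal_wfs (copure \<S>) (discarding \<S>)"
  unfolding copure_eq discarding_eq using assms by (intro monoidal_wfs_transpose mixing_pure_wfs)

section \<open>Copurification\<close>

lemma entry_lunit_comp:
  assumes "k \<in> hom A (unit_obj \<otimes>\<^sub>o B)" "b \<in> B"
  shows "entry (lunit B \<cdot> k) b a = entry k (Tup Star b) a"
proof -
  have "entry (lunit B \<cdot> k) b a
      = (\<Sum>z\<in>unit_obj \<otimes>\<^sub>o B. if z = Tup Star b then entry k z a else 0)"
    unfolding comp_def homD(2)[OF assms(1)] morphism.simps
    using assms(2) by (intro sum.cong) (auto simp: lunit_def)
  then show ?thesis
    using assms(2) homD(4)[OF assms(1)] by (simp add: unit_obj_def)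
qed

text \<open>Transposing a purification would put the auxiliary object to the right of
  \<open>B\<close>, whereas copurification wants it on the left; hence an explicit construction,
  with only copurity taken from the transpose.\<close>

lemma has_copurification_nonempty: "has_copurification nonempty_finite_sets"
  unfolding has_copurification_def
proof (intro ballI)
  fix A B and f :: "'a morphism"
  assume "A \<in> finite_sets" "B \<in> finite_sets" and f: "f \<in> hom A B"
  then have fin: "finite A" "finite B" by simp_all
  \<comment> \<open>\<open>Star\<close> keeps \<open>C\<close> nonempty when \<open>A\<close> is
    empty.\<close>
  define C where "C = insert Star A"
  have C: "finite C" "C \<in> nonempty_finite_sets"
    using fin by (auto simp: C_def nonempty_finite_sets_def)
  \<comment> \<open>\<open>c\<close> applies \<open>f\<close> and keeps a copy of the input in
    \<open>C\<close>. Row \<open>(d, b)\<close> can be nonzero only in column \<open>d\<close>, so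
    the transpose satisfies \<open>pureI\<close> with \<open>tfst\<close> for \<phi>.\<close>
  define c where "c = \<lparr>dom = A, cod = C \<otimes>\<^sub>o B,
    entry = (\<lambda>z a. if z \<in> C \<otimes>\<^sub>o B \<and> tfst z = a then entry f (tsnd z) a else 0)\<rparr>"
  have c: "c \<in> hom A (C \<otimes>\<^sub>o B)"
    using fin C f by (intro homI) (auto simp: c_def homD)
  have "transpose_mat c \<in> pure nonempty_finite_sets"
  proof (rule pureI[where \<phi> = tfst])
    show "transpose_mat c \<in> FStoch" using c by (simp add: homD)
  qed (auto simp: transpose_mat_def c_def nonempty_finite_sets_def)
  then have "c \<in> copure nonempty_finite_sets"
    by (simp add: copure_eq in_transpose_image_iff)
  moreover have "f = lunit B \<cdot> (\<epsilon> C \<otimes> ident B) \<cdot> c"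
  proof (rule morphism_eqI[OF f])
    have k: "(\<epsilon> C \<otimes> ident B) \<cdot> c \<in> hom A (unit_obj \<otimes>\<^sub>o B)"
      using fin C by (intro comp_hom[OF c tensor_hom] discard_hom ident_hom)
    then show "lunit B \<cdot> (\<epsilon> C \<otimes> ident B) \<cdot> c \<in> hom A B"
      by (rule comp_hom) (rule lunit_hom[OF fin(2)])
    fix b a
    assume ab: "b \<in> B" "a \<in> A"
    have "entry (lunit B \<cdot> (\<epsilon> C \<otimes> ident B) \<cdot> c) b a
        = (\<Sum>d\<in>C. entry (\<epsilon> C) Star d * entry c (Tup d b) a)"
      unfolding entry_lunit_comp[OF k ab(1)] entry_tensor_ident_comp[OF discard_hom[OF C(1)] c ab(1)] ..
    also have "\<dots> = (\<Sum>d\<in>C. if d = a then entry f b a else 0)"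
      using ab by (intro sum.cong) (auto simp: c_def discard_effect_def unit_obj_def)
    also have "\<dots> = entry f b a"
      using C(1) ab(2) by (simp add: C_def)
    finally show "entry f b a = entry (lunit B \<cdot> (\<epsilon> C \<otimes> ident B) \<cdot> c) b a" ..
  qed
  ultimately show "\<exists>C \<in> nonempty_finite_sets. \<exists>c \<in> hom A (C \<otimes>\<^sub>o B). c \<in> copure nonempty_finite_sets \<and>
      f = lunit B \<cdot> (\<epsilon> C \<otimes> ident B) \<cdot> c"
    using C c by blast
qed

theorem theorem12:
  shows "has_purification (nonempty_finite_sets :: 'a point set set) \<and>
    has_copurification (nonempty_finite_sets :: 'a point set set) \<and>
    (\<forall>\<S> \<in> {finite_sets, nonempty_finite_sets :: 'a point set set}.
      monoidal_wfs (mixing \<S>) (pure \<S>) \<and> monoidal_wfs (copure \<S>) (discarding \<S>))"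
  using has_purification_nonempty has_copurification_nonempty mixing_pure_wfs copure_discarding_wfs
  by blast

end
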